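(* Let $X$ be an inf-semilattice, $\Lambda$ a totally ordered set and $u:X\to\Lambda$ a quasi-Leontief function. Then $u$ is an inf-semilattice homomorphism, that is, $u(x_1\wedge x_2)=\min\{u(x_1),u(x_2)\}$ for all $x_1,x_2\in X$.
   Context: An inf-semilattice is a partially ordered set in which any two elements $x_1,x_2$ have a greatest lower bound $x_1\wedge x_2$. $u:X\to\Lambda$ is quasi-Leontief if for every $x\in X$ there is $x^\circ\in X$ with $\{x'\in X:u(x')\geqslant u(x)\}=\{x'\in X:x'\geqslant x^\circ\}$. *)

theory Defs
  imports Main
begin

definition quasi_leontief :: "('a::order \<Rightarrow> 'b::order) \<Rightarrow> bool" where
  "quasi_leontief u \<longleftrightarrow> (\<forall>x. \<exists>x0. {x'. u x' \<ge> u x} = {x'. x' \<ge> x0})"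

end

theory Submission
  imports Defs
begin

text \<open>Each upper level set of \<open>u\<close> at a value \<open>u x\<close> is a principal
  filter. Filters are upward closed, so \<open>u\<close> is monotone
  (\<open>quasi_leontief_mono\<close>), which bounds \<open>u (inf x1 x2)\<close> by the minimum.
  They are also closed under meets (\<open>quasi_leontief_le_inf\<close>), which gives the reverse
  bound at the level of the smaller value.\<close>

lemma quasi_leontiefE:
  assumes "quasi_leontief u"
  obtains x0 where "\<And>y. u x \<le> u y \<longleftrightarrow> x0 \<le> y"
  using assms unfolding quasi_leontief_def by blast

text \<open>The point \<open>x\<close> lies in its own level set, so the generator \<open>x0\<close>
  is below \<open>x\<close> and hence below everything above \<open>x\<close>.\<close>

lemma quasi_leontief_mono:
  assumes "quasi_leontief u"
  shows "mono u"
proof (rule monoI)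
  fix x y :: 'a
  assume "x \<le> y"
  obtain x0 where x0: "\<And>z. u x \<le> u z \<longleftrightarrow> x0 \<le> z"
    using quasi_leontiefE[OF assms] by blast
  have "x0 \<le> x" using x0 by blast
  with \<open>x \<le> y\<close> have "x0 \<le> y" by (rule order_trans[rotated])
  then show "u x \<le> u y" using x0 by blast
qed

lemma quasi_leontief_le_inf:
  fixes u :: "'a::semilattice_inf \<Rightarrow> 'b::order"
  assumes "quasi_leontief u" and "u x \<le> u y" and "u x \<le> u z"
  shows "u x \<le> u (inf y z)"
proof -
  obtain x0 where "\<And>y. u x \<le> u y \<longleftrightarrow> x0 \<le> y"
    using quasi_leontiefE[OF assms(1)] by blast
  with assms(2,3) show ?thesis by simp
qed

theorem lemma2p3p1:
  fixes u :: "'a::semilattice_inf \<Rightarrow> 'b::linorder"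
  assumes "quasi_leontief u"
  shows "\<forall>x1 x2. u (inf x1 x2) = min (u x1) (u x2)"
proof (intro allI antisym)
  fix x1 x2
  show "u (inf x1 x2) \<le> min (u x1) (u x2)"
    using quasi_leontief_mono[OF assms] by (simp add: monoD)
  \<comment> \<open>Level sets are known to be principal only at values of \<open>u\<close>; since
    the codomain is a linear order, the minimum is such a value, attained at \<open>x1\<close> or
    \<open>x2\<close>.\<close>
  show "min (u x1) (u x2) \<le> u (inf x1 x2)"
    using quasi_leontief_le_inf[OF assms, of x1 x1 x2]
      quasi_leontief_le_inf[OF assms, of x2 x1 x2]
    by (cases "u x1 \<le> u x2") (auto simp: min_def)
qed

end
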